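(* Let $n\ge1$. For all $A,B\in M_n(\mathbb{C})$, $$\frac1n\langle D_\phi(A),D_\phi(B)\rangle=\sum_{r=0}^{n-1}\Lambda_r(A)\,\overline{\Lambda_r(B)}.$$
   Context: Let $\omega=e^{2\pi i/n}$, let $S_n$ be the symmetric group on $\{1,\dots,n\}$ with composition $(\sigma\circ\tau)(i)=\sigma(\tau(i))$, let $\varepsilon(\sigma)$ be the sign of $\sigma$, and let $\rho=(1\,2\,\cdots\,n)$ be the cycle $\rho(i)=i+1$ for $i<n$, $\rho(n)=1$. Each orbit $\{\sigma\circ\rho^r: r\in\mathbb{Z}/n\mathbb{Z}\}$ contains exactly one permutation $\sigma^*$ with $\sigma^*(1)=1$. The orbital phase $\phi:S_n\to\mathbb{Z}/n\mathbb{Z}$ is the unique function such that $\phi(\sigma^*\circ\rho^r)=r$ for every $\sigma^*\in S_n$ with $\sigma^*(1)=1$ and every $r$. For $A=(a_{ij})\in M_n(\mathbb{C})$ put $m_\sigma(A)=\varepsilon(\sigma)\prod_{i=1}^n a_{i,\sigma(i)}$, $\Lambda_r(A)=\sum_{\sigma:\phi(\sigma)=r}m_\sigma(A)$ for $r=0,\dots,n-1$, $G_k(A)=\sum_{r=0}^{n-1}\Lambda_r(A)\omega^{kr}$, and $D_\phi(A)=(G_0(A),\dots,G_{n-1}(A))\in\mathbb{C}^n$. The orbital inner product is $\langle D_\phi(A),D_\phi(B)\rangle=\sum_{k=0}^{n-1}G_k(A)\overline{G_k(B)}$. *)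

theory Defs
  imports Complex_Main "HOL-Combinatorics.Permutations" "Jordan_Normal_Form.Conjugate"
    "Jordan_Normal_Form.Matrix"
begin

(* S_n is the set of functions sigma with "sigma permutes {1..n}". *)

definition rho :: "nat \<Rightarrow> nat \<Rightarrow> nat" where
  "rho n i = (if 1 \<le> i \<and> i < n then i + 1 else if i = n then 1 else i)"

(* Elements of Z/nZ are represented by 0, ..., n-1. *)
definition orbital_phase :: "nat \<Rightarrow> (nat \<Rightarrow> nat) \<Rightarrow> nat" where
  "orbital_phase n \<sigma> =
     (THE r. r < n \<and> (\<exists>\<tau>. \<tau> permutes {1..n} \<and> \<tau> 1 = 1 \<and> \<sigma> = \<tau> \<circ> (rho n ^^ r)))"

(* Entries of "complex mat" are indexed from 0, hence the shift. *)
definition mon :: "nat \<Rightarrow> complex mat \<Rightarrow> (nat \<Rightarrow> nat) \<Rightarrow> complex" where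
  "mon n A \<sigma> = of_int (sign \<sigma>) * (\<Prod>i = 1..n. A $$ (i - 1, \<sigma> i - 1))"

definition Lam :: "nat \<Rightarrow> nat \<Rightarrow> complex mat \<Rightarrow> complex" where
  "Lam n r A = (\<Sum>\<sigma> | \<sigma> permutes {1..n} \<and> orbital_phase n \<sigma> = r. mon n A \<sigma>)"

definition omega :: "nat \<Rightarrow> complex" where
  "omega n = exp (2 * of_real pi * \<i> / of_nat n)"

definition G :: "nat \<Rightarrow> nat \<Rightarrow> complex mat \<Rightarrow> complex" where
  "G n k A = (\<Sum>r<n. Lam n r A * omega n ^ (k * r))"

definition D_phi :: "nat \<Rightarrow> complex mat \<Rightarrow> complex vec" where
  "D_phi n A = vec n (\<lambda>k. G n k A)"

(* The library's Hermitian product on vectors, conjugate-linear in the second argument. *)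
abbreviation orbital_inner :: "complex vec \<Rightarrow> complex vec \<Rightarrow> complex" where
  "orbital_inner u v \<equiv> u \<bullet>c v"

lemma orbital_inner_D_phi:
  "orbital_inner (D_phi n A) (D_phi n B) = (\<Sum>k<n. G n k A * cnj (G n k B))"
  by (simp add: scalar_prod_def D_phi_def lessThan_atLeast0)

lemma rho_permutes: "n \<ge> 1 \<Longrightarrow> rho n permutes {1..n}"
proof (rule bij_imp_permutes)
  assume n: "n \<ge> 1"
  have "inj_on (rho n) {1..n}"
    by (auto simp: inj_on_def rho_def split: if_splits)
  moreover have "rho n ` {1..n} \<subseteq> {1..n}"
    using n by (auto simp: rho_def)
  ultimately show "bij_betw (rho n) {1..n} {1..n}"
    by (simp add: bij_betw_def endo_inj_surj)
qed (auto simp: rho_def)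

lemma rho_funpow_permutes: "n \<ge> 1 \<Longrightarrow> (rho n ^^ r) permutes {1..n}"
proof (induction r)
  case 0
  then show ?case by (simp only: funpow.simps permutes_id)
next
  case (Suc r)
  then show ?case unfolding funpow.simps by (intro permutes_compose rho_permutes)
qed

lemma rho_funpow_1: "r < n \<Longrightarrow> (rho n ^^ r) 1 = r + 1"
  by (induction r) (auto simp: rho_def)

lemma rho_funpow_n:
  assumes "n \<ge> 1" shows "rho n ^^ n = id"
proof
  fix x
  have one: "(rho n ^^ n) 1 = 1"
  proof -
    obtain m where m: "n = Suc m" using assms by (cases n) auto
    have "(rho n ^^ m) 1 = n" using rho_funpow_1[of m n] m by simp
    then show ?thesis by (simp add: m) (simp add: rho_def)
  qed
  show "(rho n ^^ n) x = id x"
  proof (cases "x \<in> {1..n}")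
    case True
    then have x: "x = (rho n ^^ (x - 1)) 1" using rho_funpow_1[of "x - 1" n] by auto
    have "(rho n ^^ n) x = (rho n ^^ (n + (x - 1))) 1" by (subst x) (simp add: funpow_add)
    also have "\<dots> = (rho n ^^ ((x - 1) + n)) 1" by (simp add: add.commute)
    also have "\<dots> = (rho n ^^ (x - 1)) ((rho n ^^ n) 1)" by (simp only: funpow_add o_apply)
    finally show ?thesis using one x by simp
  next
    case False
    then show ?thesis using rho_funpow_permutes[OF assms, of n]
      by (simp add: permutes_not_in)
  qed
qed

lemma orbit_decomp_unique:
  assumes "n \<ge> 1" "\<tau> permutes {1..n}" "\<tau> 1 = 1" "\<tau>' permutes {1..n}" "\<tau>' 1 = 1"
    and "\<tau> \<circ> (rho n ^^ r) = \<tau>' \<circ> (rho n ^^ s)" "r \<le> s" "s < n"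
  shows "r = s"
proof -
  have "\<tau> \<circ> (rho n ^^ r) = \<tau>' \<circ> (rho n ^^ (s - r)) \<circ> (rho n ^^ r)"
    using assms(6,7) by (simp add: comp_assoc flip: funpow_add)
  moreover have "surj (rho n ^^ r)"
    using rho_funpow_permutes[OF assms(1)] by (rule permutes_surj)
  ultimately have "\<tau> = \<tau>' \<circ> (rho n ^^ (s - r))"
    by (metis (no_types, lifting) comp_assoc comp_id surj_iff)
  then have "\<tau>' ((rho n ^^ (s - r)) 1) = \<tau>' 1"
    using assms(3,5) by (metis o_apply)
  then have "(rho n ^^ (s - r)) 1 = 1"
    using permutes_inj[OF assms(4)] by (simp add: inj_eq)
  then show ?thesis using rho_funpow_1[of "s - r" n] assms(7,8) by linarith
qed

lemma orbital_phase_eq: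
  assumes "n \<ge> 1" "\<tau> permutes {1..n}" "\<tau> 1 = 1" "r < n"
  shows "orbital_phase n (\<tau> \<circ> (rho n ^^ r)) = r"
  unfolding orbital_phase_def
proof (rule the_equality)
  fix s assume "s < n \<and> (\<exists>\<tau>'. \<tau>' permutes {1..n} \<and> \<tau>' 1 = 1 \<and>
    \<tau> \<circ> (rho n ^^ r) = \<tau>' \<circ> (rho n ^^ s))"
  then obtain \<tau>' where "s < n" and t: "\<tau>' permutes {1..n}" "\<tau>' 1 = 1"
    and e: "\<tau> \<circ> (rho n ^^ r) = \<tau>' \<circ> (rho n ^^ s)" by blast
  show "s = r"
  proof (cases "r \<le> s")
    case True
    then show ?thesis using orbit_decomp_unique[OF assms(1-3) t e] \<open>s < n\<close> by simp
  next
    case False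
    then show ?thesis
      using orbit_decomp_unique[OF assms(1) t assms(2,3) e[symmetric]] assms(4) by simp
  qed
qed (use assms in blast)

lemma orbit_decomp_exists:
  assumes "n \<ge> 1" "\<sigma> permutes {1..n}"
  shows "\<exists>r \<tau>. r < n \<and> \<tau> permutes {1..n} \<and> \<tau> 1 = 1 \<and> \<sigma> = \<tau> \<circ> (rho n ^^ r)"
proof -
  obtain x where x: "\<sigma> x = 1" "x \<in> {1..n}"
    using assms by (metis atLeastAtMost_iff imageE order_refl permutes_image)
  define k where "k = x - 1"
  have k: "k < n" "(rho n ^^ k) 1 = x" using x rho_funpow_1[of k n] by (auto simp: k_def)
  show ?thesis
  proof (cases "k = 0")
    case True
    then show ?thesis using k x assms
      by (intro exI[of _ 0] exI[of _ \<sigma>]) auto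
  next
    case False
    have "\<sigma> = \<sigma> \<circ> (rho n ^^ (k + (n - k)))"
      using k rho_funpow_n[OF assms(1)] by simp
    also have "\<dots> = \<sigma> \<circ> (rho n ^^ k) \<circ> (rho n ^^ (n - k))"
      by (simp only: funpow_add comp_assoc)
    finally have "\<sigma> = \<sigma> \<circ> (rho n ^^ k) \<circ> (rho n ^^ (n - k))" .
    moreover have "(\<sigma> \<circ> (rho n ^^ k)) permutes {1..n}"
      by (intro permutes_compose rho_funpow_permutes assms)
    ultimately show ?thesis using False k x
      by (intro exI[of _ "n - k"] exI[of _ "\<sigma> \<circ> (rho n ^^ k)"]) auto
  qed
qed

end

theory Submission
  imports Defs
begin

text \<open>
  The vector of the sums \<open>G n k A\<close> is the discrete Fourier transform of the vector of the
  orbital sums \<open>Lam n r A\<close>, so the identity is Parseval's for the cyclic group of order \<open>n\<close>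
  (\<open>discrete_Fourier_Parseval\<close>). It rests on the fact that the characters
  \<open>k \<mapsto> \<omega>^(k r)\<close> are pairwise orthogonal with squared norm \<open>n\<close>: the product of one
  with the conjugate of another is a geometric progression whose ratio is an \<open>n\<close>-th root of
  unity, different from 1 when the characters differ, so it sums to 0
  (\<open>omega_characters_orthogonal\<close>).
\<close>

lemma omega_power_eq_cis: "omega n ^ r = cis (2 * pi * real r / real n)"
proof -
  have "omega n = cis (2 * pi / real n)"
    by (simp add: omega_def cis_conv_exp mult_ac)
  then show ?thesis
    by (simp add: DeMoivre mult_ac)
qed

lemma omega_power_n:
  assumes "n \<ge> 1"
  shows "omega n ^ n = 1"
  using assms by (simp add: omega_power_eq_cis)

lemma omega_power_inj:
  assumes "r < n" "s < n" "omega n ^ r = omega n ^ s"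
  shows "r = s"
  using bij_betw_roots_unity[of n] assms
  by (auto simp: omega_power_eq_cis bij_betw_def dest: inj_onD)

lemma omega_power_mult_cnj: "omega n ^ r * cnj (omega n ^ r) = 1"
  by (simp add: omega_power_eq_cis cis_cnj cis_mult)

lemma omega_characters_orthogonal:
  assumes "r < n" "s < n"
  shows "(\<Sum>k<n. omega n ^ (k * r) * cnj (omega n ^ (k * s))) = (if r = s then of_nat n else 0)"
proof (cases "r = s")
  case True
  then show ?thesis
    by (simp only: omega_power_mult_cnj) simp
next
  case False
  define z where "z = omega n ^ r * cnj (omega n ^ s)"
  have "z \<noteq> 1"
  proof
    assume "z = 1"
    have "omega n ^ r = omega n ^ r * (omega n ^ s * cnj (omega n ^ s))"
      by (simp only: omega_power_mult_cnj mult_1_right)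
    also have "\<dots> = z * omega n ^ s"
      by (simp only: z_def mult_ac)
    finally have "omega n ^ r = omega n ^ s"
      using \<open>z = 1\<close> by simp
    with omega_power_inj[OF assms] False show False by blast
  qed
  moreover have "z ^ n = 1"
  proof -
    have "z ^ n = (omega n ^ n) ^ r * cnj ((omega n ^ n) ^ s)"
      by (simp add: z_def power_mult_distrib mult.commute flip: power_mult)
    then show ?thesis
      using omega_power_n[of n] assms by simp
  qed
  ultimately have "(\<Sum>k<n. z ^ k) = 0"
    by (simp add: geometric_sum)
  moreover have "omega n ^ (k * r) * cnj (omega n ^ (k * s)) = z ^ k" for k
    by (simp add: z_def power_mult_distrib mult.commute flip: power_mult)
  ultimately show ?thesis
    using False by simp
qed

text \<open>
  Expanding both transforms gives a triple sum; once the frequency \<open>k\<close> is summed first,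
  orthogonality leaves only the diagonal, each term weighted by \<open>n\<close>.
\<close>

lemma discrete_Fourier_Parseval:
  fixes f g :: "nat \<Rightarrow> complex"
  shows "(\<Sum>k<n. (\<Sum>r<n. f r * omega n ^ (k * r)) * cnj (\<Sum>s<n. g s * omega n ^ (k * s)))
         = of_nat n * (\<Sum>r<n. f r * cnj (g r))"
proof -
  have "(\<Sum>k<n. (\<Sum>r<n. f r * omega n ^ (k * r)) * cnj (\<Sum>s<n. g s * omega n ^ (k * s)))
      = (\<Sum>k<n. \<Sum>r<n. \<Sum>s<n.
           f r * cnj (g s) * (omega n ^ (k * r) * cnj (omega n ^ (k * s))))"
    by (simp add: sum_product mult_ac)
  also have "\<dots> = (\<Sum>r<n. \<Sum>k<n. \<Sum>s<n.
           f r * cnj (g s) * (omega n ^ (k * r) * cnj (omega n ^ (k * s))))"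
    by (rule sum.swap)
  also have "\<dots> = (\<Sum>r<n. \<Sum>s<n. \<Sum>k<n.
           f r * cnj (g s) * (omega n ^ (k * r) * cnj (omega n ^ (k * s))))"
    by (intro sum.cong refl sum.swap)
  also have "\<dots> = (\<Sum>r<n. \<Sum>s<n. f r * cnj (g s) * (if r = s then of_nat n else 0))"
    by (intro sum.cong refl)
       (simp add: omega_characters_orthogonal del: complex_cnj_power flip: sum_distrib_left)
  also have "\<dots> = of_nat n * (\<Sum>r<n. f r * cnj (g r))"
    by (simp add: sum_distrib_left if_distrib mult_ac cong: if_cong)
  finally show ?thesis .
qed

theorem proposition9p2:
  fixes n :: nat and A B :: "complex mat"
  assumes "n \<ge> 1" and "A \<in> carrier_mat n n" and "B \<in> carrier_mat n n"
  shows "1 / of_nat n * orbital_inner (D_phi n A) (D_phi n B)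
         = (\<Sum>r<n. Lam n r A * cnj (Lam n r B))"
proof -
  have "orbital_inner (D_phi n A) (D_phi n B) = of_nat n * (\<Sum>r<n. Lam n r A * cnj (Lam n r B))"
    unfolding orbital_inner_D_phi G_def by (rule discrete_Fourier_Parseval)
  then show ?thesis
    using assms(1) by simp
qed

end
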